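(* Let $N\ge 1$ be an integer and let $P_n(x)$, $n=0,1,\dots,N$, be the Sturmian sequence of polynomials on the quadratic grid $x_s=s(s+1)$, $s=0,1,\dots,N$. Then for $n=0,1,\dots,N$ the polynomial $P_n(x)$ coincides with the monic Racah polynomial $R_n(x;\alpha,\beta,\gamma,\delta)$ with the parameters $$\alpha=-N-1,\qquad \beta=-N-\tfrac12,\qquad \gamma=\tfrac12,\qquad \delta=-\tfrac12 .$$
   Context: Sturmian sequence on a grid: given distinct real numbers $x_0,\dots,x_N$, put $P_{N+1}(x)=\prod_{s=0}^N(x-x_s)$ and $P_N(x)=(N+1)^{-1}P_{N+1}'(x)$. The Euclidean algorithm produces uniquely monic polynomials $P_{N-1},\dots,P_0=1$ ($\deg P_n=n$), real $b_n$ and $u_n>0$ with $P_{n+1}(x)=(x-b_n)P_n(x)-u_nP_{n-1}(x)$ for $n=1,\dots,N$, and $P_1(x)=x-b_0$. The polynomials $P_0,\dots,P_N$ form the Sturmian sequence. Racah polynomials with $\alpha=-N-1$: for $0\le n\le N$, $R_n(x;\alpha,\beta,\gamma,\delta)$ is the monic polynomial of degree $n$ in $x$ determined by $$R_n(x(s);\alpha,\beta,\gamma,\delta)=\kappa_n\;{}_4F_3\left({-n,\ n+\beta-N,\ -s,\ s+\gamma+\delta+1\atop -N,\ \beta+\delta+1,\ \gamma+1};1\right),\qquad x(s)=s(s+\gamma+\delta+1),$$ where $\kappa_n$ is the constant making the polynomial monic in $x$, and the series is the finite sum of its terms with index $k=0,\dots,n$ (each product $(-s)_k(s+\gamma+\delta+1)_k$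 is a polynomial of degree $k$ in $x(s)$; $(y)_k=y(y+1)\cdots(y+k-1)$). *)

theory Defs
  imports "HOL-Computational_Algebra.Computational_Algebra"
begin

text \<open>
  \<^term>\<open>sturmian_sequence N x P\<close>: the values \<open>P 0, \<dots>, P N\<close> form the Sturmian sequence on
  the grid \<open>x 0, \<dots>, x N\<close>. The value \<open>P (N + 1)\<close> is the polynomial vanishing on the grid, from
  which the Euclidean algorithm starts; the values of \<open>P\<close> beyond \<open>N + 1\<close>, and the values of
  \<open>x\<close> beyond \<open>N\<close>, are irrelevant. Distinctness of the grid points is not part of the predicate;
  it is what makes the sequence exist (\<open>sturmian_sequence_exists\<close> below).
\<close>

definition sturmian_sequence :: "nat \<Rightarrow> (nat \<Rightarrow> real) \<Rightarrow> (nat \<Rightarrow> real poly) \<Rightarrow> bool" where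
  "sturmian_sequence N x P \<longleftrightarrow>
     P (N + 1) = (\<Prod>s\<le>N. [:- x s, 1:]) \<and>
     P N = smult (1 / (real N + 1)) (pderiv (P (N + 1))) \<and>
     (\<forall>n\<le>N. degree (P n) = n \<and> lead_coeff (P n) = 1) \<and>
     (\<exists>b u. (\<forall>n\<in>{1..N}. u n > 0 \<and>
                P (n + 1) = [:- b n, 1:] * P n - smult (u n) (P (n - 1))) \<and>
            P 1 = [:- b 0, 1:])"

text \<open>
  Truncated after the term of index \<open>n\<close>. The truncation matters for \<open>\<alpha> = - N - 1\<close>, where the
  lower parameter \<open>\<alpha> + 1 = - N\<close> makes later denominators vanish.
\<close>

definition racah_4F3 :: "nat \<Rightarrow> real \<Rightarrow> real \<Rightarrow> real \<Rightarrow> real \<Rightarrow> real \<Rightarrow> real" where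
  "racah_4F3 n \<alpha> \<beta> \<gamma> \<delta> s =
     (\<Sum>k\<le>n. fps_nth (fps_hypergeo
        [- real n, real n + \<alpha> + \<beta> + 1, - s, s + \<gamma> + \<delta> + 1]
        [\<alpha> + 1, \<beta> + \<delta> + 1, \<gamma> + 1] 1) k)"

definition is_monic_racah ::
    "nat \<Rightarrow> real \<Rightarrow> real \<Rightarrow> real \<Rightarrow> real \<Rightarrow> real poly \<Rightarrow> bool" where
  "is_monic_racah n \<alpha> \<beta> \<gamma> \<delta> R \<longleftrightarrow>
     degree R = n \<and> lead_coeff R = 1 \<and>
     (\<exists>\<kappa>. \<forall>s. poly R (s * (s + \<gamma> + \<delta> + 1)) = \<kappa> * racah_4F3 n \<alpha> \<beta> \<gamma> \<delta> s)"

text \<open>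
  Uniqueness is \<open>is_monic_racah_unique\<close>; existence, for parameters such that all denominators
  and the leading coefficient are nonzero, is \<open>is_monic_racah_exists\<close>.
\<close>

definition racah :: "nat \<Rightarrow> real \<Rightarrow> real \<Rightarrow> real \<Rightarrow> real \<Rightarrow> real poly" where
  "racah n \<alpha> \<beta> \<gamma> \<delta> = (THE R. is_monic_racah n \<alpha> \<beta> \<gamma> \<delta> R)"

lemma poly_eq_if_eq_on_quadratic_range:
  fixes p q :: "real poly"
  assumes "\<And>s. poly p (s * (s + c)) = poly q (s * (s + c))"
  shows "p = q"
proof -
  have "poly (p \<circ>\<^sub>p [:0, c, 1:]) s = poly (q \<circ>\<^sub>p [:0, c, 1:]) s" for s
    using assms[of s] by (simp add: poly_pcompose algebra_simps)
  then have "(p - q) \<circ>\<^sub>p [:0, c, 1:] = 0"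
    by (simp add: poly_eq_poly_eq_iff[symmetric] pcompose_diff fun_eq_iff)
  then show ?thesis
    by (subst (asm) pcompose_eq_0_iff) auto
qed

lemma is_monic_racah_unique:
  assumes "is_monic_racah n \<alpha> \<beta> \<gamma> \<delta> R" "is_monic_racah n \<alpha> \<beta> \<gamma> \<delta> R'"
  shows "R = R'"
proof -
  from assms obtain k k' where
      k: "\<And>s. poly R (s * (s + \<gamma> + \<delta> + 1)) = k * racah_4F3 n \<alpha> \<beta> \<gamma> \<delta> s"
    and k': "\<And>s. poly R' (s * (s + \<gamma> + \<delta> + 1)) = k' * racah_4F3 n \<alpha> \<beta> \<gamma> \<delta> s"
    unfolding is_monic_racah_def by blast
  have *: "smult k' R = smult k R'"
    by (rule poly_eq_if_eq_on_quadratic_range[where c = "\<gamma> + \<delta> + 1"])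
       (use k k' in \<open>simp add: add.assoc\<close>)
  have lc: "coeff R n = 1" "coeff R' n = 1"
    using assms by (auto simp: is_monic_racah_def)
  from arg_cong[OF *, of "\<lambda>p. coeff p n"] lc have "k = k'" by simp
  moreover have "k \<noteq> 0"
  proof
    assume "k = 0"
    then have "R = 0"
      by (intro poly_eq_if_eq_on_quadratic_range[where c = "\<gamma> + \<delta> + 1"])
         (use k in \<open>simp add: add.assoc\<close>)
    with lc show False by simp
  qed
  ultimately show ?thesis
    using * by (simp add: smult_eq_iff)
qed

lemma racah_eqI: "is_monic_racah n \<alpha> \<beta> \<gamma> \<delta> R \<Longrightarrow> racah n \<alpha> \<beta> \<gamma> \<delta> = R"
  unfolding racah_def by (blast intro: the_equality is_monic_racah_unique)

lemma pochhammer_quadratic: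
  "pochhammer (- s) k * pochhammer (s + c) k =
     poly (\<Prod>i<k. [:real i * (real i + c), - 1:]) (s * (s + c))" for s c :: real
  by (induction k) (auto simp: pochhammer_Suc algebra_simps)

lemma is_monic_racah_exists:
  assumes "pochhammer (real n + \<alpha> + \<beta> + 1) n \<noteq> 0"
    and "pochhammer (\<alpha> + 1) n \<noteq> 0" "pochhammer (\<beta> + \<delta> + 1) n \<noteq> 0" "pochhammer (\<gamma> + 1) n \<noteq> 0"
  shows "\<exists>R. is_monic_racah n \<alpha> \<beta> \<gamma> \<delta> R"
proof -
  define c where "c = \<gamma> + \<delta> + 1"
  define a where "a k = pochhammer (- real n) k * pochhammer (real n + \<alpha> + \<beta> + 1) k /
     (pochhammer (\<alpha> + 1) k * pochhammer (\<beta> + \<delta> + 1) k * pochhammer (\<gamma> + 1) k * fact k)" for k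
  define q where "q k = (\<Prod>i<k. [:real i * (real i + c), - 1:])" for k
  define p where "p = (\<Sum>k\<le>n. smult (a k) (q k))"
  have deg_q: "degree (q k) = k" for k
    unfolding q_def by (subst degree_prod_eq_sum_degree) auto
  have lc_q: "coeff (q k) k = (- 1) ^ k" for k
    using lead_coeff_prod[of "\<lambda>i. [:real i * (real i + c), - 1:]" "{..<k}"] deg_q[of k]
    by (simp add: q_def)
  have "a n \<noteq> 0"
    using assms by (auto simp: a_def pochhammer_eq_0_iff)
  have "coeff p n = (\<Sum>k\<le>n. a k * coeff (q k) n)"
    by (simp add: p_def coeff_sum)
  also have "\<dots> = (\<Sum>k\<in>{n}. a k * coeff (q k) n)"
    by (rule sum.mono_neutral_right) (auto simp: coeff_eq_0 deg_q)
  finally have cp: "coeff p n = a n * (- 1) ^ n" by (simp add: lc_q)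
  with \<open>a n \<noteq> 0\<close> have "coeff p n \<noteq> 0" by simp
  moreover have "degree p \<le> n"
    unfolding p_def by (rule degree_sum_le) (auto simp: deg_q order_trans[OF degree_smult_le])
  ultimately have deg_p: "degree p = n"
    by (simp add: le_antisym le_degree)
  have eval: "poly p (s * (s + \<gamma> + \<delta> + 1)) = racah_4F3 n \<alpha> \<beta> \<gamma> \<delta> s" for s
  proof -
    have "poly p (s * (s + c)) = (\<Sum>k\<le>n. a k * (pochhammer (- s) k * pochhammer (s + c) k))"
      unfolding p_def q_def by (simp only: poly_sum poly_smult pochhammer_quadratic)
    also have "\<dots> = racah_4F3 n \<alpha> \<beta> \<gamma> \<delta> s"
      unfolding racah_4F3_def by (intro sum.cong) (simp_all add: a_def c_def add_ac)
    finally show ?thesis by (simp add: c_def add_ac)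
  qed
  have "is_monic_racah n \<alpha> \<beta> \<gamma> \<delta> (smult (1 / coeff p n) p)"
    unfolding is_monic_racah_def using deg_p \<open>coeff p n \<noteq> 0\<close> eval
    by (auto intro!: exI[of _ "1 / coeff p n"])
  then show ?thesis by blast
qed

lemma sturmian_sequence_unique:
  assumes P: "sturmian_sequence N x P" and Q: "sturmian_sequence N x Q" and "n \<le> N"
  shows "P n = Q n"
proof -
  from P obtain b u where p: "\<And>n. n \<in> {1..N} \<Longrightarrow> u n > 0 \<and>
      P (n + 1) = [:- b n, 1:] * P n - smult (u n) (P (n - 1))"
    unfolding sturmian_sequence_def by blast
  from Q obtain c v where q: "\<And>n. n \<in> {1..N} \<Longrightarrow> v n > 0 \<and>
      Q (n + 1) = [:- c n, 1:] * Q n - smult (v n) (Q (n - 1))"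
    unfolding sturmian_sequence_def by blast
  have deg: "degree (P n) = n" "lead_coeff (P n) = 1" "degree (Q n) = n" "lead_coeff (Q n) = 1"
    if "n \<le> N" for n
    using P Q that unfolding sturmian_sequence_def by auto
  have "k \<le> N \<Longrightarrow> P (N - k) = Q (N - k) \<and> P (N - k + 1) = Q (N - k + 1)" for k
  proof (induction k)
    case 0
    then show ?case using P Q by (simp add: sturmian_sequence_def)
  next
    case (Suc k)
    define m where "m = N - k"
    have m: "m \<in> {1..N}" "N - Suc k = m - 1" "m - 1 + 1 = m" "m - 1 < m"
      using Suc.prems by (auto simp: m_def)
    have IH: "P m = Q m" "P (m + 1) = Q (m + 1)"
      using Suc by (auto simp: m_def)
    have "P m \<noteq> 0" using deg[of m] m by force
    have *: "R (m + 1) mod R m = - smult w (R (m - 1))"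
      if "R (m + 1) = [:- d, 1:] * R m - smult w (R (m - 1))"
        "degree (R m) = m" "degree (R (m - 1)) = m - 1" for R :: "nat \<Rightarrow> real poly" and d w
    proof -
      have "R (m + 1) = - smult w (R (m - 1)) + [:- d, 1:] * R m"
        using that(1) by simp
      then have "R (m + 1) mod R m = (- smult w (R (m - 1))) mod R m"
        by (metis mod_mult_self1 mult.commute)
      also have "\<dots> = - smult w (R (m - 1))"
        by (rule mod_poly_less) (use that m degree_smult_le[of w "R (m - 1)"] in auto)
      finally show ?thesis .
    qed
    have "- smult (u m) (P (m - 1)) = - smult (v m) (Q (m - 1))"
    proof -
      have "P (m + 1) mod P m = - smult (u m) (P (m - 1))"
        by (rule *[of P "b m"]) (use p[of m] deg[of m] deg[of "m - 1"] m in auto)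
      moreover have "Q (m + 1) mod Q m = - smult (v m) (Q (m - 1))"
        by (rule *[of Q "c m"]) (use q[of m] deg[of m] deg[of "m - 1"] m in auto)
      ultimately show ?thesis using IH by simp
    qed
    then have eq: "smult (u m) (P (m - 1)) = smult (v m) (Q (m - 1))" by simp
    have "u m = v m"
      using arg_cong[OF eq, of "\<lambda>r. coeff r (m - 1)"] deg[of "m - 1"] m by auto
    with eq p[of m] m have "P (m - 1) = Q (m - 1)"
      by (auto simp: smult_eq_iff)
    with IH m show ?case by simp
  qed
  from this[of "N - n"] \<open>n \<le> N\<close> show ?thesis by simp
qed

text \<open>Existence: the remainders are orthogonal with respect to a positive discrete measure.\<close>

lemma sum_div_pderiv_eq_0:
  fixes x :: "nat \<Rightarrow> real" and f :: "real poly"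
  assumes inj: "inj_on x {..N}" and deg: "\<And>k. k \<ge> N \<Longrightarrow> coeff f k = 0"
  shows "(\<Sum>s\<le>N. poly f (x s) / (\<Prod>t\<in>{..N} - {s}. x s - x t)) = 0"
proof -
  define l where "l s = (\<Prod>t\<in>{..N} - {s}. [:- x t, 1:])" for s
  define d where "d s = (\<Prod>t\<in>{..N} - {s}. x s - x t)" for s
  define g where "g = (\<Sum>s\<le>N. smult (poly f (x s) / d s) (l s))"
  have d0: "d s \<noteq> 0" if "s \<le> N" for s
    using that inj by (auto simp: d_def inj_on_def)
  have ev: "poly (l s) (x r) = (if r = s then d s else 0)" if "s \<le> N" "r \<le> N" for r s
    using that by (auto simp: l_def d_def poly_prod)
  have dl: "degree (l s) = N" if "s \<le> N" for s
    using that unfolding l_def by (subst degree_prod_eq_sum_degree) auto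
  have ll: "coeff (l s) N = 1" if "s \<le> N" for s
    using lead_coeff_prod[of "\<lambda>t. [:- x t, 1:]" "{..N} - {s}"] dl[OF that]
    by (simp add: l_def)
  have "f = g"
  proof (rule poly_eqI_degree)
    fix y assume "y \<in> x ` {..N}"
    then obtain r where r: "r \<le> N" "y = x r" by auto
    have "poly g y = (\<Sum>s\<le>N. if s = r then poly f (x s) else 0)"
      unfolding g_def poly_sum by (intro sum.cong) (use r ev d0 in auto)
    also have "\<dots> = poly f y" using r by simp
    finally show "poly f y = poly g y" ..
  next
    have "degree g \<le> N"
      unfolding g_def by (rule degree_sum_le) (auto intro: order_trans[OF degree_smult_le] simp: dl)
    then show "degree g < card (x ` {..N})" using inj by (simp add: card_image)
    show "degree f < card (x ` {..N})"
      using inj degree_le[of N f] deg by (simp add: card_image less_Suc_eq_le)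
  qed
  then have "coeff g N = 0" using deg by blast
  moreover have "coeff g N = (\<Sum>s\<le>N. poly f (x s) / d s)"
    unfolding g_def coeff_sum by (intro sum.cong) (auto simp: ll)
  ultimately show ?thesis by (simp add: d_def)
qed

definition discrete_functional ::
    "nat \<Rightarrow> (nat \<Rightarrow> real) \<Rightarrow> (nat \<Rightarrow> real) \<Rightarrow> real poly \<Rightarrow> real" where
  "discrete_functional N x w f = (\<Sum>s\<le>N. w s * poly f (x s))"

lemma discrete_functional_linear:
  "discrete_functional N x w (f + g) = discrete_functional N x w f + discrete_functional N x w g"
  "discrete_functional N x w (f - g) = discrete_functional N x w f - discrete_functional N x w g"
  "discrete_functional N x w (smult a f) = a * discrete_functional N x w f"
  by (simp_all add: discrete_functional_def algebra_simps sum.distrib sum_subtractf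
      sum_distrib_left)

lemma discrete_functional_square_pos:
  assumes "inj_on x {..N}" "\<And>s. s \<le> N \<Longrightarrow> w s > 0" "f \<noteq> 0" "degree f \<le> N"
  shows "discrete_functional N x w (f * f) > 0"
proof -
  have "\<exists>s\<le>N. poly f (x s) \<noteq> 0"
  proof (rule ccontr)
    assume "\<not> ?thesis"
    then have "f = 0"
      by (intro poly_eqI_degree[of "x ` {..N}"]) (use assms in \<open>auto simp: card_image\<close>)
    with assms show False by simp
  qed
  then obtain s where "s \<le> N" "poly f (x s) \<noteq> 0" by blast
  then have "w s * (poly f (x s))\<^sup>2 > 0" using assms(2) by simp
  with \<open>s \<le> N\<close> show ?thesis
    unfolding discrete_functional_def poly_mult power2_eq_square[symmetric]
    by (intro sum_pos2[of _ s]) (use assms(2) in \<open>auto simp: less_imp_le\<close>)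
qed

lemma euclid_step:
  assumes inj: "inj_on x {..N}" and w: "\<And>s. s \<le> N \<Longrightarrow> w s > 0" and n: "n < N"
  defines "L \<equiv> discrete_functional N x w"
  assumes A: "degree A = n + 2" "lead_coeff A = 1"
      "\<And>f. (\<And>k. k \<ge> n + 2 \<Longrightarrow> coeff f k = 0) \<Longrightarrow> L (A * f) = 0"
    and B: "degree B = n + 1" "lead_coeff B = 1"
      "\<And>f. (\<And>k. k \<ge> n + 1 \<Longrightarrow> coeff f k = 0) \<Longrightarrow> L (B * f) = 0"
  obtains b u C where "u > 0" "A = [:- b, 1:] * B - smult u C" "degree C = n" "lead_coeff C = 1"
    "\<And>f. (\<And>k. k \<ge> n \<Longrightarrow> coeff f k = 0) \<Longrightarrow> L (C * f) = 0"
proof -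
  note lin = discrete_functional_linear[of N x w, folded L_def]
  have pos: "L (f * f) > 0" if "f \<noteq> 0" "degree f \<le> N" for f
    unfolding L_def using discrete_functional_square_pos[OF inj w that] .
  define b where "b = coeff B n - coeff A (n + 1)"
  define X where "X = [:- b, 1:]"
  define r where "r = A - X * B"
  have cX: "coeff (X * f) (Suc k) = coeff f k - b * coeff f (Suc k)" for f k
    by (simp add: X_def)
  have r0: "coeff r k = 0" if "k \<ge> n + 1" for k
  proof -
    define j where "j = k - 1"
    have j: "k = Suc j" "j \<ge> n" using that by (auto simp: j_def)
    consider "j = n" | "j = n + 1" | "j \<ge> n + 2" using j by linarith
    then show ?thesis
      unfolding r_def coeff_diff j cX
      by cases (use A B in \<open>auto simp: b_def coeff_eq_0\<close>)
  qed
  have Lr: "L (r * f) = - L (B * (X * f))" if "\<And>k. k \<ge> n + 1 \<Longrightarrow> coeff f k = 0" for f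
  proof -
    have "r * f = A * f - B * (X * f)" by (simp add: r_def algebra_simps)
    moreover have "L (A * f) = 0" by (rule A(3)) (use that in auto)
    ultimately show ?thesis by (simp only: lin)
  qed
  have Lr0: "L (r * f) = 0" if f: "\<And>k. k \<ge> n \<Longrightarrow> coeff f k = 0" for f
  proof -
    have "L (B * (X * f)) = 0"
    proof (rule B(3))
      fix k assume "n + 1 \<le> k"
      then show "coeff (X * f) k = 0" using f cX by (cases k) auto
    qed
    then show ?thesis using Lr f by auto
  qed
  have BB: "L (B * B) > 0" using B n by (intro pos) auto
  have Lrn: "L (r * monom 1 n) = - L (B * B)"
  proof -
    have "L (B * (X * monom 1 n - B)) = 0"
    proof (rule B(3))
      fix k assume "n + 1 \<le> k"
      then obtain j where j: "k = Suc j" "j \<ge> n" by (auto dest: Suc_le_D)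
      then show "coeff (X * monom 1 n - B) k = 0"
        unfolding coeff_diff j cX using B by (cases "j = n") (auto simp: coeff_eq_0)
    qed
    then have "L (B * (X * monom 1 n)) = L (B * B)"
      by (simp only: right_diff_distrib lin)
    then show ?thesis by (subst Lr) auto
  qed
  define c where "c = coeff r n"
  have "r \<noteq> 0"
    using Lrn BB by (auto simp: L_def discrete_functional_def)
  moreover have deg_r: "degree r \<le> n" by (rule degree_le) (use r0 in auto)
  ultimately have "L (r * r) > 0" using n by (intro pos) auto
  moreover have "L (r * r) = - c * L (B * B)"
  proof -
    have "L (r * (r - smult c (monom 1 n))) = 0"
    proof (rule Lr0)
      fix k assume "n \<le> k"
      then show "coeff (r - smult c (monom 1 n)) k = 0"
        using r0[of k] by (cases "k = n") (auto simp: c_def)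
    qed
    then have "L (r * r) = c * L (r * monom 1 n)"
      by (simp add: right_diff_distrib lin)
    then show ?thesis using Lrn by simp
  qed
  ultimately have c: "c < 0" using BB by (simp add: mult_less_0_iff)
  show thesis
  proof (rule that[of "- c" b "smult (1 / c) r"])
    show "A = [:- b, 1:] * B - smult (- c) (smult (1 / c) r)"
      using c by (simp add: r_def X_def)
    have "degree r = n"
      using deg_r c by (simp add: c_def le_antisym le_degree)
    then show "degree (smult (1 / c) r) = n" "lead_coeff (smult (1 / c) r) = 1"
      using c by (auto simp: c_def)
    show "L (smult (1 / c) r * f) = 0" if "\<And>k. k \<ge> n \<Longrightarrow> coeff f k = 0" for f
      using Lr0[OF that] by (simp only: mult_smult_left lin)
  qed (use c in auto)
qed

lemma sturmian_sequence_exists: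
  assumes inj: "inj_on x {..N}"
  shows "\<exists>P. sturmian_sequence N x P"
proof -
  define G where "G = (\<Prod>s\<le>N. [:- x s, 1:])"
  define H where "H = smult (1 / (real N + 1)) (pderiv G)"
  define w where "w s = 1 / (poly H (x s))\<^sup>2" for s
  define L where "L = discrete_functional N x w"
  have degG: "degree G = N + 1"
    unfolding G_def by (subst degree_prod_eq_sum_degree) auto
  have lcG: "lead_coeff G = 1"
    unfolding G_def by (simp add: lead_coeff_prod)
  have degH: "degree H = N" and lcH: "lead_coeff H = 1"
    using degG lcG by (auto simp: H_def degree_pderiv coeff_pderiv add.commute)
  have H: "poly H (x s) = (\<Prod>t\<in>{..N} - {s}. x s - x t) / (real N + 1)" if s: "s \<le> N" for s
  proof -
    have "poly (pderiv G) (x s) = (\<Sum>a\<le>N. \<Prod>t\<in>{..N} - {a}. x s - x t)"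
      by (simp add: G_def pderiv_prod poly_sum poly_prod pderiv_pCons)
    also have "\<dots> = (\<Sum>a\<in>{s}. \<Prod>t\<in>{..N} - {a}. x s - x t)"
      by (rule sum.mono_neutral_right) (use s in \<open>auto intro!: prod_zero\<close>)
    finally show ?thesis by (simp add: H_def)
  qed
  have H0: "poly H (x s) \<noteq> 0" if "s \<le> N" for s
    using H[OF that] that inj by (auto simp: inj_on_def)
  then have w: "w s > 0" if "s \<le> N" for s using that by (simp add: w_def)
  have LG: "L (G * f) = 0" for f
    unfolding L_def discrete_functional_def
    by (intro sum.neutral) (auto simp: G_def poly_prod intro!: prod_zero)
  have LH: "L (H * f) = 0" if f: "\<And>k. k \<ge> N \<Longrightarrow> coeff f k = 0" for f
  proof -
    have "L (H * f) = (\<Sum>s\<le>N. (real N + 1) * (poly f (x s) / (\<Prod>t\<in>{..N} - {s}. x s - x t)))"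
      unfolding L_def discrete_functional_def
      by (intro sum.cong refl) (use H0 H in \<open>auto simp: w_def power2_eq_square\<close>)
    also have "\<dots> = 0"
      unfolding sum_distrib_left[symmetric] by (simp only: sum_div_pderiv_eq_0[OF inj f] mult_zero_right)
    finally show ?thesis .
  qed
  define good where
    "good n f \<longleftrightarrow> degree f = n \<and> lead_coeff f = 1 \<and>
       (\<forall>g. (\<forall>k\<ge>n. coeff g k = 0) \<longrightarrow> L (f * g) = 0)" for n and f :: "real poly"
  have "\<exists>P b u. P (N + 1) = G \<and> P N = H \<and> (\<forall>n\<in>{N - k..N + 1}. good n (P n)) \<and>
          (\<forall>n\<in>{N - k<..N}. u n > 0 \<and> P (n + 1) = [:- b n, 1:] * P n - smult (u n) (P (n - 1)))"
    if "k \<le> N" for k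
    using that
  proof (induction k)
    case 0
    have "good n (if n = N then H else G)" if "n \<in> {N..N + 1}" for n
      using that degG lcG degH lcH LG LH by (auto simp: good_def le_Suc_eq)
    then show ?case
      by (intro exI[of _ "\<lambda>n. if n = N then H else G"]) auto
  next
    case (Suc k)
    define m where "m = N - Suc k"
    have m: "N - k = m + 1" "m < N" using Suc.prems by (auto simp: m_def)
    obtain P b u where P: "P (N + 1) = G" "P N = H" "\<forall>n\<in>{m + 1..N + 1}. good n (P n)"
        "\<forall>n\<in>{m + 1<..N}. u n > 0 \<and> P (n + 1) = [:- b n, 1:] * P n - smult (u n) (P (n - 1))"
      using Suc.IH Suc.prems unfolding m by auto
    have "good (m + 2) (P (m + 2))" "good (m + 1) (P (m + 1))" using P(3) m by auto
    then obtain u' b' C where C: "u' > 0" "P (m + 2) = [:- b', 1:] * P (m + 1) - smult u' C"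
        "good m C"
      unfolding good_def L_def
      by (elim conjE) (rule euclid_step[OF inj w m(2), where A = "P (m + 2)" and B = "P (m + 1)"], auto)
    let ?P = "P(m := C)" and ?b = "b(m + 1 := b')" and ?u = "u(m + 1 := u')"
    have "?P (N + 1) = G" "?P N = H" using P m by auto
    moreover have "good n (?P n)" if "n \<in> {m..N + 1}" for n
      using that P(3) C(3) by (cases "n = m") auto
    moreover have "?u n > 0 \<and> ?P (n + 1) = [:- ?b n, 1:] * ?P n - smult (?u n) (?P (n - 1))"
      if "n \<in> {m<..N}" for n
    proof (cases "n = m + 1")
      case True
      then show ?thesis using C by simp
    next
      case False
      then have "n \<in> {m + 1<..N}" using that by auto
      moreover from this have "n \<noteq> m" "n - 1 \<noteq> m" "n + 1 \<noteq> m" by auto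
      ultimately show ?thesis using P(4) False by auto
    qed
    ultimately show ?case
      unfolding m_def[symmetric] by (intro exI[of _ ?P] exI[of _ ?b] exI[of _ ?u]) blast
  qed
  from this[of N] obtain P b u where P: "P (N + 1) = G" "P N = H" "\<forall>n\<in>{0..N + 1}. good n (P n)"
      "\<forall>n\<in>{0<..N}. u n > 0 \<and> P (n + 1) = [:- b n, 1:] * P n - smult (u n) (P (n - 1))"
    by auto
  have "degree (P 1) = 1" "lead_coeff (P 1) = 1"
    using bspec[OF P(3), of 1] by (auto simp: good_def)
  then have P1: "P 1 = [:- (- coeff (P 1) 0), 1:]"
    by (intro poly_eqI) (auto simp: coeff_pCons coeff_eq_0 split: nat.splits)
  have "sturmian_sequence N x P"
    unfolding sturmian_sequence_def
  proof (intro conjI)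
    show "P (N + 1) = (\<Prod>s\<le>N. [:- x s, 1:])" "P N = smult (1 / (real N + 1)) (pderiv (P (N + 1)))"
      using P by (auto simp: G_def H_def)
    show "\<forall>n\<le>N. degree (P n) = n \<and> lead_coeff (P n) = 1"
      using P(3) unfolding good_def by (metis atLeastAtMost_iff le0 trans_le_add1)
    show "\<exists>b u. (\<forall>n\<in>{1..N}. u n > 0 \<and>
              P (n + 1) = [:- b n, 1:] * P n - smult (u n) (P (n - 1))) \<and> P 1 = [:- b 0, 1:]"
      by (rule exI[of _ "b(0 := - coeff (P 1) 0)"], rule exI[of _ u]) (use P(4) P1 in auto)
  qed
  then show ?thesis by blast
qed

end

theory Submission
  imports Defs
begin

text \<open>
  On the grid \<open>x s = s * (s + 1)\<close> the product
  \<open>pochhammer (- s) k * pochhammer (s + 1) k\<close> is, up to sign, the Newton basis polynomial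
  \<open>\<Prod>i<k. x - x i\<close>. The hypergeometric series therefore is a Newton expansion, and
  \<open>racah_newton N n\<close> is its monic normalization. The Newton basis suits the Sturmian
  sequence equally well: its element of index \<open>N + 1\<close> is the grid polynomial from which the
  Euclidean algorithm starts.

  As the Sturmian sequence is determined by its defining properties, it is enough that
  \<open>racah_newton N\<close> has them. Since \<open>x\<close> times the \<open>k\<close>-th basis element is the next one
  plus \<open>x k\<close> times the \<open>k\<close>-th (\<open>linear_times_newton_sum\<close>), each property becomes an
  identity between closed-form coefficients.

  \<^item> At degree \<open>N + 1\<close> the parameter \<open>- N\<close> kills every coefficient except the leading one,
    which leaves the grid polynomial (\<open>racah_newton_Suc_N\<close>).
  \<^item> Expanding the derivative of the grid polynomial by the product rule along \<open>N\<close> gives a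
    recursion for its coefficients, which the closed form satisfies (\<open>racah_coeff_top_rec\<close>,
    \<open>pderiv_newton_basis\<close>). Here the individual values of \<open>\<gamma>\<close> and \<open>\<delta>\<close> matter, beyond
    \<open>\<gamma> + \<delta> = 0\<close>, which only fixes the grid.
  \<^item> The three-term recurrence, valid for Racah polynomials in general, persists up to \<open>n = N\<close>
    (\<open>racah_coeff_rec\<close>). After removal of the common Pochhammer factors it is an identity of
    rational functions of \<open>n\<close>, \<open>k\<close>, \<open>N\<close>, and its coefficient \<open>u\<close> is positive for
    \<open>1 \<le> n \<le> N\<close> by inspection of signs (\<open>racah_u_pos\<close>).

  The denominators of the coefficients and of the recurrence vanish nowhere, because each of
  their factors is half of an odd integer.
\<close>

section \<open>Newton expansions\<close>

definition newton_basis :: "(nat \<Rightarrow> real) \<Rightarrow> nat \<Rightarrow> real poly" where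
  "newton_basis x k = (\<Prod>i<k. [:- x i, 1:])"

definition newton_sum :: "(nat \<Rightarrow> real) \<Rightarrow> nat \<Rightarrow> (nat \<Rightarrow> real) \<Rightarrow> real poly" where
  "newton_sum x n f = (\<Sum>k\<le>n. smult (f k) (newton_basis x k))"

text \<open>
  The coefficients that result when every basis element is replaced by the next one.
\<close>

definition shift_up :: "(nat \<Rightarrow> real) \<Rightarrow> nat \<Rightarrow> real" where
  "shift_up f k = (case k of 0 \<Rightarrow> 0 | Suc j \<Rightarrow> f j)"

lemma shift_up_simps [simp]: "shift_up f 0 = 0" "shift_up f (Suc j) = f j"
  by (simp_all add: shift_up_def)

lemma degree_newton_basis: "degree (newton_basis x k) = k"
  unfolding newton_basis_def by (subst degree_prod_eq_sum_degree) auto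

lemma coeff_newton_basis_top: "coeff (newton_basis x k) k = 1"
  using lead_coeff_prod[of "\<lambda>i. [:- x i, 1:]" "{..<k}"] degree_newton_basis[of x k]
  by (simp add: newton_basis_def)

lemma newton_basis_Suc: "newton_basis x (Suc k) = [:- x k, 1:] * newton_basis x k"
  by (simp only: newton_basis_def prod.lessThan_Suc mult.commute)

lemma newton_sum_top:
  assumes "f n = 1"
  shows "degree (newton_sum x n f) = n" "coeff (newton_sum x n f) n = 1"
proof -
  have "coeff (newton_sum x n f) n = (\<Sum>k\<le>n. f k * coeff (newton_basis x k) n)"
    by (simp add: newton_sum_def coeff_sum)
  also have "\<dots> = (\<Sum>k\<in>{n}. f k * coeff (newton_basis x k) n)"
    by (rule sum.mono_neutral_right) (auto simp: coeff_eq_0 degree_newton_basis)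
  finally show top: "coeff (newton_sum x n f) n = 1"
    using assms by (simp add: coeff_newton_basis_top)
  have "degree (newton_sum x n f) \<le> n"
    unfolding newton_sum_def
    by (rule degree_sum_le) (auto intro: order_trans[OF degree_smult_le] simp: degree_newton_basis)
  then show "degree (newton_sum x n f) = n"
    using top by (simp add: le_antisym le_degree)
qed

lemma newton_sum_extend:
  assumes "n \<le> m" "\<And>k. n < k \<Longrightarrow> k \<le> m \<Longrightarrow> f k = 0"
  shows "newton_sum x n f = newton_sum x m f"
  unfolding newton_sum_def by (rule sum.mono_neutral_left) (use assms in auto)

text \<open>
  Write \<open>X - b = (X - x k) + (x k - b)\<close> in front of the \<open>k\<close>-th basis element: the first
  summand raises the index, the second is a scalar. The hypothesis makes the term of index
  \<open>Suc n\<close> come from the index shift alone.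
\<close>

lemma linear_times_newton_sum:
  assumes "f (Suc n) = 0"
  shows "[:- b, 1:] * newton_sum x n f =
    newton_sum x (Suc n) (\<lambda>k. shift_up f k + (x k - b) * f k)"
proof -
  have mult: "[:- b, 1:] * newton_basis x k =
      newton_basis x (Suc k) + smult (x k - b) (newton_basis x k)" for k
    by (simp add: newton_basis_Suc algebra_simps flip: smult_add_left)
  have "[:- b, 1:] * newton_sum x n f =
      (\<Sum>k\<le>n. smult (f k) ([:- b, 1:] * newton_basis x k))"
    by (simp only: newton_sum_def sum_distrib_left mult_smult_right)
  also have "\<dots> = (\<Sum>k\<le>n. smult (f k) (newton_basis x (Suc k))) +
      (\<Sum>k\<le>n. smult ((x k - b) * f k) (newton_basis x k))"
    by (simp only: mult smult_add_right sum.distrib smult_smult mult.commute[of "f _"])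
  also have "(\<Sum>k\<le>n. smult (f k) (newton_basis x (Suc k))) =
      newton_sum x (Suc n) (shift_up f)"
    unfolding newton_sum_def by (simp only: sum.atMost_Suc_shift shift_up_simps) simp
  also have "(\<Sum>k\<le>n. smult ((x k - b) * f k) (newton_basis x k)) =
      newton_sum x (Suc n) (\<lambda>k. (x k - b) * f k)"
    using assms by (simp add: newton_sum_def)
  finally show ?thesis
    by (simp add: newton_sum_def smult_add_left sum.distrib)
qed

lemma newton_sum_cong:
  "(\<And>k. k \<le> n \<Longrightarrow> f k = g k) \<Longrightarrow> newton_sum x n f = newton_sum x n g"
  by (simp add: newton_sum_def)

lemma smult_sum_right: "smult c (\<Sum>k\<in>A. f k) = (\<Sum>k\<in>A. smult c (f k))"
  by (induction A rule: infinite_finite_induct) (simp_all add: smult_add_right)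

lemma newton_sum_add:
  "newton_sum x n f + newton_sum x n g = newton_sum x n (\<lambda>k. f k + g k)"
  by (simp add: newton_sum_def smult_add_left sum.distrib)

lemma smult_newton_sum: "smult c (newton_sum x n f) = newton_sum x n (\<lambda>k. c * f k)"
  by (simp add: newton_sum_def smult_sum_right)

lemma newton_sum_diff:
  "newton_sum x n f - newton_sum x n g = newton_sum x n (\<lambda>k. f k - g k)"
  by (simp add: newton_sum_def smult_diff_left sum_subtractf)

section \<open>The expansion coefficients of the Racah polynomials\<close>

text \<open>
  The coefficient of the \<open>k\<close>-th Newton basis polynomial in the monic Racah polynomial of degree
  \<open>n\<close>. If \<open>a k\<close> is the \<open>k\<close>-th coefficient of the hypergeometric series, this is
  \<open>(- 1) ^ (n - k) * a k / a n\<close>: in the quotient of \<open>pochhammer z k\<close> by \<open>pochhammer z n\<close>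
  only the factors from \<open>z + k\<close> on survive. The lower parameters \<open>- N\<close> thereby move
  into the numerator, so that the formula still makes sense for \<open>n = N + 1\<close>, where the
  series itself does not.
\<close>

definition racah_coeff :: "nat \<Rightarrow> nat \<Rightarrow> nat \<Rightarrow> real" where
  "racah_coeff N n k = real (n choose k) * (pochhammer (real k - real N) (n - k))\<^sup>2 *
     pochhammer (real k + 3/2) (n - k) /
     pochhammer (real n + real k - 2 * real N - 1/2) (n - k)"

lemma racah_coeff_simps: "racah_coeff N n n = 1" "n < k \<Longrightarrow> racah_coeff N n k = 0"
  by (simp_all add: racah_coeff_def)

lemma half_odd_neq_0: "real_of_int i - 1/2 \<noteq> 0"
proof
  assume "real_of_int i - 1/2 = 0"
  then have "real_of_int (2 * i) = real_of_int 1" by simp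
  then have "2 * i = 1" by (simp only: of_int_eq_iff)
  then show False by presburger
qed

lemma pochhammer_half_odd_neq_0: "pochhammer (real_of_int i - 1/2) m \<noteq> 0"
proof
  assume "pochhammer (real_of_int i - 1/2) m = 0"
  then obtain j where "real_of_int i - 1/2 = - real j"
    by (auto simp: pochhammer_eq_0_iff)
  then have "real_of_int (i + int j) - 1/2 = 0" by simp
  then show False using half_odd_neq_0 by blast
qed

section \<open>The three-term recurrence\<close>

text \<open>
  The standard Racah recurrence
  \<open>x * R n = A n * R (n + 1) - (A n + C n) * R n + C n * R (n - 1)\<close>, for \<open>R\<close> normalized to be
  the hypergeometric series itself, at \<open>\<alpha> = - N - 1\<close>, \<open>\<beta> = - N - 1/2\<close>,
  \<open>\<gamma> = 1/2\<close>, \<open>\<delta> = - 1/2\<close>. Passing to monic polynomials turns it into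
  \<open>racah_b\<close> and \<open>racah_u\<close> below.
\<close>

definition racah_A :: "real \<Rightarrow> real \<Rightarrow> real" where
  "racah_A N n = (n - N)\<^sup>2 * (n - 2 * N - 1/2) * (n + 3/2) /
     ((2 * n - 2 * N - 1/2) * (2 * n - 2 * N + 1/2))"

definition racah_C :: "real \<Rightarrow> real \<Rightarrow> real" where
  "racah_C N n = n * (n - 2 * N - 2) * (n - N - 1/2)\<^sup>2 /
     ((2 * n - 2 * N - 3/2) * (2 * n - 2 * N - 1/2))"

definition racah_b :: "real \<Rightarrow> real \<Rightarrow> real" where
  "racah_b N n = - (racah_A N n + racah_C N n)"

definition racah_u :: "real \<Rightarrow> real \<Rightarrow> real" where
  "racah_u N n = racah_A N (n - 1) * racah_C N n"

text \<open>
  Both \<open>racah_A N (n - 1)\<close> and \<open>racah_C N n\<close> are negative: their numerators contain exactly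
  one negative factor, their denominators two.
\<close>

lemma racah_u_pos:
  fixes n N :: real
  assumes "1 \<le> n" "n \<le> N"
  shows "racah_u N n > 0"
proof -
  have "(n - 1 - N)\<^sup>2 * (n - 1 - 2 * N - 1/2) * (n - 1 + 3/2) < 0"
    using assms by (intro mult_neg_pos mult_pos_neg) auto
  moreover have "(2 * (n - 1) - 2 * N - 1/2) * (2 * (n - 1) - 2 * N + 1/2) > 0"
    using assms by (intro mult_neg_neg) auto
  ultimately have A: "racah_A N (n - 1) < 0"
    unfolding racah_A_def by (rule divide_neg_pos)
  have "n * (n - 2 * N - 2) * (n - N - 1/2)\<^sup>2 < 0"
    using assms by (intro mult_neg_pos mult_pos_neg) auto
  moreover have "(2 * n - 2 * N - 3/2) * (2 * n - 2 * N - 1/2) > 0"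
    using assms by (intro mult_neg_neg) auto
  ultimately have "racah_C N n < 0"
    unfolding racah_C_def by (rule divide_neg_pos)
  with A show ?thesis unfolding racah_u_def by (rule mult_neg_neg)
qed

text \<open>
  The recurrence for the expansion coefficients, divided by their common factors. The
  denominators \<open>\<rho>\<close> and \<open>\<sigma>\<close> serve as independent variables next to \<open>n\<close>: they replace
  \<open>N\<close> and \<open>k\<close>, and clearing denominators then leaves a polynomial identity.
\<close>

lemma recurrence_identity:
  fixes n k N b :: real
  defines "\<rho> \<equiv> 2 * n - 2 * N - 1/2" and "\<sigma> \<equiv> n + k - 2 * N - 1/2"
  assumes nz: "\<rho> \<noteq> 0" "\<rho> - 1 \<noteq> 0" "\<rho> + 1 \<noteq> 0" "\<sigma> \<noteq> 0" "\<sigma> - 1 \<noteq> 0"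
  assumes b: "b = - ((n - N)\<^sup>2 * (n - 2 * N - 1/2) * (n + 3/2) / (\<rho> * (\<rho> + 1))
     + n * (n - 2 * N - 2) * (n - N - 1/2)\<^sup>2 / ((\<rho> - 1) * \<rho>))"
  shows "(n + 1) * (n - N)\<^sup>2 * (n + 3/2) / (\<rho> * (\<rho> + 1)) =
     k * (k - 1 - N)\<^sup>2 * (k + 1/2) / ((\<sigma> - 1) * \<sigma>)
     + (n - k + 1) * (k * (k + 1) - b) / \<sigma>
     - (n - k + 1) * (n - k) * (n - 2 * N - 3/2) * (n - 2 * N - 2) * (n - N - 1/2)\<^sup>2
        / ((\<rho> - 1) * \<rho> * ((\<sigma> - 1) * \<sigma>))"
proof -
  have N: "N = n - \<rho>/2 - 1/4" by (simp add: \<rho>_def field_simps)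
  have k: "k = \<sigma> - \<rho> + n" by (simp add: \<rho>_def \<sigma>_def)
  show ?thesis unfolding b using nz
    by (simp add: divide_simps) (unfold k N, algebra)
qed

text \<open>
  With \<open>m = n - 1 - k\<close>, all four coefficients are multiples of the same Pochhammer symbols of
  length \<open>m\<close>, with elementary factors. Dividing out the product \<open>W\<close> of everything they share
  leaves \<open>recurrence_identity\<close>.
\<close>

lemma racah_coeff_rec_interior:
  fixes N k m :: nat
  defines "n \<equiv> Suc (k + m)"
  shows "racah_coeff N (Suc n) k = shift_up (racah_coeff N n) k
    + (real k * (real k + 1) - racah_b N n) * racah_coeff N n k
    - racah_u N n * racah_coeff N (n - 1) k"
proof -
  define \<rho> where "\<rho> = 2 * real n - 2 * real N - 1/2"
  define \<sigma> where "\<sigma> = real n + real k - 2 * real N - 1/2"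
  define S where "S = pochhammer (real k - real N) m"
  define H where "H = pochhammer (real k + 3/2) m"
  define E where "E = pochhammer (\<sigma> + 1) m"
  define F where "F = (fact (k + m) / (fact k * fact (Suc m)) :: real)"
  have "\<rho> + real_of_int i \<noteq> 0" for i
    using half_odd_neq_0[of "2 * int n - 2 * int N + i"] by (simp add: \<rho>_def algebra_simps)
  from this[of 0] this[of "-1"] this[of 1] this[of "-2"]
  have \<rho>: "\<rho> \<noteq> 0" "\<rho> - 1 \<noteq> 0" "\<rho> + 1 \<noteq> 0" "\<rho> - 2 \<noteq> 0" by auto
  have "\<sigma> + real_of_int i \<noteq> 0" for i
    using half_odd_neq_0[of "int n + int k - 2 * int N + i"] by (simp add: \<sigma>_def algebra_simps)
  from this[of 0] this[of "-1"] have \<sigma>: "\<sigma> \<noteq> 0" "\<sigma> - 1 \<noteq> 0" by auto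
  have \<sigma>\<rho>: "\<sigma> = \<rho> - 1 - real m"
    by (simp add: \<rho>_def \<sigma>_def n_def)
  have E1: "pochhammer \<sigma> (Suc m) = \<sigma> * E"
    by (simp add: E_def pochhammer_rec)
  have E2: "pochhammer (\<sigma> + 1) (Suc (Suc m)) = E * \<rho> * (\<rho> + 1)"
    by (simp add: E_def pochhammer_Suc \<sigma>\<rho> algebra_simps)
  have E3: "pochhammer (\<sigma> - 1) (Suc (Suc m)) = (\<sigma> - 1) * \<sigma> * E"
    by (simp add: pochhammer_rec[of "\<sigma> - 1"] E1)
  have "pochhammer (\<sigma> - 1) m * ((\<rho> - 2) * (\<rho> - 1)) = (\<sigma> - 1) * \<sigma> * E"
    unfolding E3[symmetric] by (simp add: pochhammer_Suc \<sigma>\<rho> algebra_simps)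
  then have E4: "pochhammer (\<sigma> - 1) m = (\<sigma> - 1) * \<sigma> * E / ((\<rho> - 2) * (\<rho> - 1))"
    using \<rho> by (simp add: eq_divide_eq)
  define W where "W = real n * F * S\<^sup>2 * (real n - 1 - real N)\<^sup>2 * (real n + 1/2) * H
     / (E * (real n - real k + 1))"
  have nk: "real n - real k + 1 = real m + 2" "real n = real k + real m + 1"
    by (simp_all add: n_def)
  have S1: "pochhammer (real k - real N) (Suc m) = S * (real n - 1 - real N)"
    by (simp add: S_def pochhammer_Suc nk algebra_simps)
  have S2: "pochhammer (real k - real N) (Suc (Suc m)) =
      S * (real n - 1 - real N) * (real n - real N)"
    by (subst pochhammer_Suc) (simp add: S1, simp add: nk algebra_simps)
  have H1: "pochhammer (real k + 3/2) (Suc m) = H * (real n + 1/2)"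
    by (simp add: H_def pochhammer_Suc nk algebra_simps)
  have H2: "pochhammer (real k + 3/2) (Suc (Suc m)) = H * (real n + 1/2) * (real n + 3/2)"
    by (subst pochhammer_Suc) (simp add: H1, simp add: nk algebra_simps)
  have m12: "1 + real m \<noteq> 0" "2 + real m \<noteq> 0" "real m + 1 \<noteq> 0" "real m + 2 \<noteq> 0" "1 + (1 + real m) \<noteq> 0"
    by linarith+
  have b0: "real (n - 1 choose k) = F * (real m + 1)"
    by (simp add: n_def F_def binomial_fact divide_simps m12)
  have b1: "real (n choose k) = F * real n"
    by (simp add: n_def F_def binomial_fact Suc_diff_le divide_simps m12)
        (simp add: algebra_simps)?
  have b2: "real (Suc n choose k) = F * real n * (real n + 1) / (real m + 2)"
    by (simp add: n_def F_def binomial_fact Suc_diff_le divide_simps m12)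
        (simp add: algebra_simps)?
  have c0: "racah_coeff N (n - 1) k =
      F * (real m + 1) * S\<^sup>2 * H * ((\<rho> - 2) * (\<rho> - 1)) / ((\<sigma> - 1) * \<sigma> * E)"
  proof -
    have "real (n - 1) + real k - 2 * real N - 1/2 = \<sigma> - 1" "n - 1 - k = m"
      by (auto simp: \<sigma>_def n_def)
    then show ?thesis
      unfolding racah_coeff_def b0 by (simp add: E4 S_def H_def)
  qed
  have c1: "racah_coeff N n k = W * ((real m + 2) / \<sigma>)"
  proof -
    have "n - k = Suc m" by (simp add: n_def)
    then show ?thesis
      unfolding racah_coeff_def b1 \<sigma>_def[symmetric] W_def nk(1)
      unfolding \<open>n - k = Suc m\<close> E1 S1 H1 using m12 by (simp add: power_mult_distrib mult_ac)
  qed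
  have c2: "racah_coeff N (Suc n) k =
      W * ((real n + 1) * (real n - real N)\<^sup>2 * (real n + 3/2) / (\<rho> * (\<rho> + 1)))"
  proof -
    have P: "Suc n - k = Suc (Suc m)" "real (Suc n) + real k - 2 * real N - 1/2 = \<sigma> + 1"
      by (simp_all add: n_def \<sigma>_def)
    then show ?thesis
      unfolding racah_coeff_def b2 W_def nk(1)
      unfolding P E2 S2 H2 using m12 by (simp add: power_mult_distrib mult_ac)
  qed
  have c3: "shift_up (racah_coeff N n) k =
      W * (real k * (real k - 1 - real N)\<^sup>2 * (real k + 1/2) / ((\<sigma> - 1) * \<sigma>))"
  proof (cases k)
    case (Suc j)
    have b3: "real (n choose j) = F * real n * real k / (real m + 2)"
      by (simp add: n_def F_def Suc binomial_fact Suc_diff_le divide_simps m12)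
        (simp add: algebra_simps)?
    have P: "n - j = Suc (Suc m)" "real n + real j - 2 * real N - 1/2 = \<sigma> - 1"
        "real j = real k - 1"
      by (simp_all add: n_def \<sigma>_def Suc)
    have "pochhammer (real k - 1 - real N) (Suc (Suc m)) =
        (real k - 1 - real N) * (S * (real n - 1 - real N))"
      by (subst pochhammer_rec) (simp add: S1)
    moreover have "pochhammer (real k - 1 + 3/2) (Suc (Suc m)) =
        (real k + 1/2) * (H * (real n + 1/2))"
      using pochhammer_rec[of "real k + 1/2" "Suc m"] H1 by (simp add: add.commute)
    ultimately show ?thesis
      unfolding Suc shift_up_simps unfolding racah_coeff_def b3 P(1,2) E3 W_def nk(1) Suc[symmetric]
      unfolding P(3)
      using m12 by (simp add: power_mult_distrib mult_ac)
  qed auto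
  have uc: "racah_u N n * racah_coeff N (n - 1) k = W * ((real m + 2) * (real m + 1)
      * (real n - 2 * real N - 3/2) * (real n - 2 * real N - 2) * (real n - real N - 1/2)\<^sup>2
        / ((\<rho> - 1) * \<rho> * ((\<sigma> - 1) * \<sigma>)))"
  proof -
    have A: "racah_A N (real n - 1) = (real n - 1 - real N)\<^sup>2 * (real n - 2 * real N - 3/2) *
        (real n + 1/2) / ((\<rho> - 2) * (\<rho> - 1))"
      by (simp add: racah_A_def \<rho>_def algebra_simps)
    have C: "racah_C N n = real n * (real n - 2 * real N - 2) * (real n - real N - 1/2)\<^sup>2 /
       ((\<rho> - 1) * \<rho>)"
      by (simp add: racah_C_def \<rho>_def algebra_simps)
    have regroup: "p * x * h / (r2 * r1) * (j * y * z / (r1 * r0)) *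
        (F * m1 * S\<^sup>2 * H * (r2 * r1) / (t * E)) =
        j * F * S\<^sup>2 * p * h * H / (E * m2) * (m2 * m1 * x * y * z / (r1 * r0 * t))"
      if "r2 \<noteq> 0" "r1 \<noteq> 0" "m2 \<noteq> 0" for p x h r2 r1 j y z r0 m1 m2 t :: real
      using that by (simp add: mult_ac)
    show ?thesis
      unfolding racah_u_def A C c0 W_def nk(1) by (rule regroup) (use \<rho> m12 in auto)
  qed
  have b: "racah_b N n = - ((real n - real N)\<^sup>2 * (real n - 2 * real N - 1/2) * (real n + 3/2)
       / (\<rho> * (\<rho> + 1))
     + real n * (real n - 2 * real N - 2) * (real n - real N - 1/2)\<^sup>2 / ((\<rho> - 1) * \<rho>))"
    by (simp add: racah_b_def racah_A_def racah_C_def \<rho>_def algebra_simps)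
  have "real n - real k = real m + 1" by (simp add: nk)
  note identity = recurrence_identity[of n N k, folded \<rho>_def \<sigma>_def, OF \<rho>(1-3) \<sigma> b,
      unfolded nk(1), unfolded this]
  have scale: "W * l = W * p + y * (W * (q / \<sigma>)) - W * r"
    if "l = p + q * y / \<sigma> - r" for l p q r y
    unfolding that by (simp add: algebra_simps)
  show ?thesis
    unfolding c1 c2 c3 uc by (rule scale[OF identity])
qed

text \<open>
  The case \<open>k = n\<close> escapes the previous lemma, since \<open>m\<close> would be \<open>- 1\<close>; there the term with
  \<open>racah_u\<close> drops out and the identity says that \<open>racah_b\<close> is the right second coefficient.
\<close>

lemma racah_coeff_rec:
  assumes "n \<ge> 1" "k \<le> Suc n"
  shows "racah_coeff N (Suc n) k = shift_up (racah_coeff N n) k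
    + (real k * (real k + 1) - racah_b N n) * racah_coeff N n k
    - racah_u N n * racah_coeff N (n - 1) k"
proof -
  consider m where "n = Suc (k + m)" | "k = n" | "k = Suc n"
    using assms by (metis add_Suc le_SucE less_iff_Suc_add not_less nat_less_le)
  then show ?thesis
  proof cases
    case 1
    then show ?thesis using racah_coeff_rec_interior[of N k] by simp
  next
    case 2
    define \<rho> where "\<rho> = 2 * real n - 2 * real N - 1/2"
    have "\<rho> + real_of_int i \<noteq> 0" for i
      using half_odd_neq_0[of "2 * int n - 2 * int N + i"] by (simp add: \<rho>_def algebra_simps)
    from this[of 0] this[of "-1"] this[of 1]
    have \<rho>: "\<rho> \<noteq> 0" "\<rho> - 1 \<noteq> 0" "\<rho> + 1 \<noteq> 0" by auto
    obtain j where j: "n = Suc j" using assms by (cases n) auto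
    have c2: "racah_coeff N (Suc n) n = (real n + 1) * (real n - real N)\<^sup>2 * (real n + 3/2) / (\<rho> + 1)"
      by (simp add: racah_coeff_def \<rho>_def algebra_simps)
    have c1: "shift_up (racah_coeff N n) n =
        real n * (real n - 1 - real N)\<^sup>2 * (real n + 1/2) / (\<rho> - 1)"
      by (simp add: racah_coeff_def \<rho>_def j algebra_simps)
    have b: "racah_b N n = - ((real n - real N)\<^sup>2 * (real n - 2 * real N - 1/2) * (real n + 3/2)
         / (\<rho> * (\<rho> + 1))
       + real n * (real n - 2 * real N - 2) * (real n - real N - 1/2)\<^sup>2 / ((\<rho> - 1) * \<rho>))"
      by (simp add: racah_b_def racah_A_def racah_C_def \<rho>_def algebra_simps)
    have N: "real N = real n - \<rho>/2 - 1/4" by (simp add: \<rho>_def field_simps)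
    have "racah_coeff N (Suc n) n = shift_up (racah_coeff N n) n + (real n * (real n + 1) - racah_b N n)"
      unfolding c1 c2 b using \<rho> by (simp add: divide_simps) (unfold N, algebra)
    then show ?thesis using j unfolding 2 by (simp add: racah_coeff_simps)
  next
    case 3
    then show ?thesis using assms by (simp add: racah_coeff_simps)
  qed
qed
abbreviation quadratic_grid :: "nat \<Rightarrow> real" where
  "quadratic_grid s \<equiv> real s * (real s + 1)"

definition racah_newton :: "nat \<Rightarrow> nat \<Rightarrow> real poly" where
  "racah_newton N n = newton_sum quadratic_grid n (racah_coeff N n)"

lemma racah_newton_degree:
  "degree (racah_newton N n) = n" "lead_coeff (racah_newton N n) = 1"
  using newton_sum_top[of "racah_coeff N n" n quadratic_grid]
  by (simp_all add: racah_newton_def racah_coeff_simps)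

lemma racah_newton_rec:
  assumes "n \<ge> 1"
  shows "racah_newton N (n + 1) =
    [:- racah_b N n, 1:] * racah_newton N n - smult (racah_u N n) (racah_newton N (n - 1))"
proof -
  have prev: "racah_newton N (n - 1) =
      newton_sum quadratic_grid (Suc n) (racah_coeff N (n - 1))"
    unfolding racah_newton_def by (rule newton_sum_extend) (use assms in \<open>auto simp: racah_coeff_simps\<close>)
  show ?thesis
    unfolding prev unfolding racah_newton_def
    by (subst linear_times_newton_sum)
       (auto simp: newton_sum_diff smult_newton_sum racah_coeff_simps racah_coeff_rec[OF assms]
          simp del: mult_pCons_left intro!: newton_sum_cong)
qed

text \<open>
  The Pochhammer symbol of \<open>k - N\<close> of length \<open>N + 1 - k\<close> runs through \<open>0\<close> when
  \<open>k \<le> N\<close>, so only the leading coefficient survives.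
\<close>

lemma racah_newton_Suc_N:
  "racah_newton N (N + 1) = newton_basis quadratic_grid (N + 1)"
proof -
  have "racah_coeff N (Suc N) k = 0" if "k \<le> N" for k
  proof -
    have "pochhammer (real k - real N) (Suc N - k) = 0"
      unfolding pochhammer_eq_0_iff using that by (intro exI[of _ "N - k"]) auto
    then show ?thesis by (simp add: racah_coeff_def)
  qed
  then show ?thesis
    by (simp add: racah_newton_def newton_sum_def racah_coeff_simps)
qed

section \<open>The derivative of the grid polynomial\<close>

text \<open>
  This is the product rule for the derivative of the grid polynomial, read on Newton
  coefficients, as the proof of \<open>pderiv_newton_basis\<close> shows. With \<open>m = N - k\<close> everything is
  a multiple of the same Pochhammer symbols of length \<open>m\<close>.
\<close>

lemma racah_coeff_top_rec:
  assumes "k \<le> Suc N"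
  shows "(real N + 2) * racah_coeff (Suc N) (Suc N) k =
    (real N + 1) * (shift_up (racah_coeff N N) k +
      (quadratic_grid k - quadratic_grid (Suc N)) * racah_coeff N N k) + (if k = Suc N then 1 else 0)"
proof (cases "k = Suc N")
  case True
  then show ?thesis by (simp add: racah_coeff_simps)
next
  case False
  define m where "m = N - k"
  have N: "N = k + m" using assms False by (simp add: m_def)
  define A where "A = pochhammer (- real m) m"
  define B where "B = pochhammer (- real m - 1/2) m"
  define H where "H = pochhammer (real k + 3/2) m"
  define D where "D = (fact N / (fact k * fact m) :: real)"
  have A1: "pochhammer (- real m - 1) (Suc m) = - ((real m + 1) * A)"
    using pochhammer_rec[of "- real m - 1" m] by (simp add: A_def algebra_simps)
  have B1: "pochhammer (- real m - 3/2) (Suc m) = - ((real m + 3/2) * B)"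
    using pochhammer_rec[of "- real m - 3/2" m] by (simp add: B_def algebra_simps)
  have m1: "1 + real m \<noteq> 0" "real m + 1 \<noteq> 0" "real m + 3/2 \<noteq> 0" by linarith+
  have b0: "real (N choose k) = D"
    by (simp add: D_def N binomial_fact)
  have b1: "real (Suc N choose k) = D * (real N + 1) / (real m + 1)"
    by (simp add: D_def N binomial_fact Suc_diff_le divide_simps m1) (simp add: algebra_simps)
  have c0: "racah_coeff N N k = D * A\<^sup>2 * H / B"
  proof -
    have P: "real N + real k - 2 * real N - 1/2 = - real m - 1/2" "N - k = m"
        "real k - real N = - real m"
      by (auto simp: N)
    then show ?thesis
      unfolding racah_coeff_def b0 P A_def B_def H_def by simp
  qed
  have regroup: "D * p / q * (- (q * A))\<^sup>2 * (H * h) / (- (r * B)) =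
      D * A\<^sup>2 * H / B * (- (p * q * h / r))" if "q \<noteq> 0" for p q r h
    using that by (simp add: power2_eq_square mult_ac)
  have c1: "racah_coeff (Suc N) (Suc N) k =
      D * A\<^sup>2 * H / B * (- ((real N + 1) * (real m + 1) * (real N + 3/2) / (real m + 3/2)))"
  proof -
    have P: "real (Suc N) + real k - 2 * real (Suc N) - 1/2 = - real m - 3/2" "Suc N - k = Suc m"
        "real k - real (Suc N) = - real m - 1"
      by (auto simp: N)
    have H1: "pochhammer (real k + 3/2) (Suc m) = H * (real N + 3/2)"
      by (simp add: H_def pochhammer_Suc N algebra_simps)
    show ?thesis
      unfolding racah_coeff_def b1 P A1 B1 H1 by (rule regroup) (rule m1)
  qed
  have c2: "shift_up (racah_coeff N N) k =
      D * A\<^sup>2 * H / B * (- (real k * (real m + 1) * (real k + 1/2) / (real m + 3/2)))"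
  proof (cases k)
    case (Suc j)
    have P: "real N + real j - 2 * real N - 1/2 = - real m - 3/2" "N - j = Suc m"
        "real j - real N = - real m - 1"
      by (auto simp: N Suc)
    have b2: "real (N choose j) = D * real k / (real m + 1)"
      by (simp add: D_def N Suc binomial_fact Suc_diff_le divide_simps m1)
    have H2: "pochhammer (real j + 3/2) (Suc m) = H * (real k + 1/2)"
      using pochhammer_rec[of "real k + 1/2" m] by (simp add: H_def Suc add_ac)
    show ?thesis
      unfolding Suc shift_up_simps unfolding Suc[symmetric] racah_coeff_def b2 P A1 B1 H2
      by (rule regroup) (rule m1)
  qed auto
  have "(real N + 2) * (- ((real N + 1) * (real m + 1) * (real N + 3/2) / (real m + 3/2))) =
      (real N + 1) * ((- (real k * (real m + 1) * (real k + 1/2) / (real m + 3/2))) +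
      (quadratic_grid k - quadratic_grid (Suc N)))"
    using m1(3) by (simp add: N divide_simps) (simp add: algebra_simps)
  from arg_cong[OF this, of "\<lambda>y. D * A\<^sup>2 * H / B * y"]
  have "(real N + 2) * (D * A\<^sup>2 * H / B * (- ((real N + 1) * (real m + 1) * (real N + 3/2) / (real m + 3/2)))) =
      (real N + 1) * (D * A\<^sup>2 * H / B * (- (real k * (real m + 1) * (real k + 1/2) / (real m + 3/2))) +
      (quadratic_grid k - quadratic_grid (Suc N)) * (D * A\<^sup>2 * H / B))"
    by (simp only: distrib_left mult_ac)
  then show ?thesis
    unfolding c0 c1 c2 using False by simp
qed

lemma pderiv_newton_basis:
  "pderiv (newton_basis quadratic_grid (Suc N)) = smult (real N + 1) (racah_newton N N)"
proof (induction N)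
  case 0
  then show ?case
    by (simp add: newton_basis_def racah_newton_def newton_sum_def racah_coeff_simps pderiv_pCons)
next
  case (Suc N)
  let ?x = quadratic_grid
  have "pderiv (newton_basis ?x (Suc (Suc N))) =
      smult (real N + 1) ([:- ?x (Suc N), 1:] * racah_newton N N) + newton_basis ?x (Suc N)"
    by (subst newton_basis_Suc, subst pderiv_mult, subst Suc.IH, subst mult_smult_right)
       (simp add: pderiv_pCons del: mult_pCons_left)
  also have "[:- ?x (Suc N), 1:] * racah_newton N N = newton_sum ?x (Suc N)
      (\<lambda>k. shift_up (racah_coeff N N) k + (?x k - ?x (Suc N)) * racah_coeff N N k)"
    unfolding racah_newton_def by (rule linear_times_newton_sum) (simp add: racah_coeff_simps)
  also have "newton_basis ?x (Suc N) = newton_sum ?x (Suc N) (\<lambda>k. if k = Suc N then 1 else 0)"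
    by (simp add: newton_sum_def)
  also have "smult (real N + 1) (newton_sum ?x (Suc N)
        (\<lambda>k. shift_up (racah_coeff N N) k + (?x k - ?x (Suc N)) * racah_coeff N N k)) + \<dots> =
      newton_sum ?x (Suc N) (\<lambda>k. (real N + 1) * (shift_up (racah_coeff N N) k +
        (?x k - ?x (Suc N)) * racah_coeff N N k) + (if k = Suc N then 1 else 0))"
    by (simp only: smult_newton_sum newton_sum_add)
  also have "\<dots> = newton_sum ?x (Suc N) (\<lambda>k. (real N + 2) * racah_coeff (Suc N) (Suc N) k)"
    by (intro newton_sum_cong racah_coeff_top_rec[symmetric])
  also have "\<dots> = smult (real N + 2) (racah_newton (Suc N) (Suc N))"
    by (simp only: racah_newton_def smult_newton_sum)
  finally show ?case by (simp add: add.commute)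
qed

section \<open>Identification with the Sturmian sequence\<close>

lemma sturmian_sequence_racah_newton:
  "sturmian_sequence N quadratic_grid (racah_newton N)"
  unfolding sturmian_sequence_def
proof (intro conjI allI impI)
  show "racah_newton N (N + 1) = (\<Prod>s\<le>N. [:- quadratic_grid s, 1:])"
    by (simp add: racah_newton_Suc_N[simplified] newton_basis_def lessThan_Suc_atMost del: prod.lessThan_Suc)
  show "racah_newton N N = smult (1 / (real N + 1)) (pderiv (racah_newton N (N + 1)))"
    unfolding racah_newton_Suc_N using pderiv_newton_basis[of N] by simp
  show "\<exists>b u. (\<forall>n\<in>{1..N}. u n > 0 \<and> racah_newton N (n + 1) =
      [:- b n, 1:] * racah_newton N n - smult (u n) (racah_newton N (n - 1))) \<and>
      racah_newton N 1 = [:- b 0, 1:]"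
  proof -
    \<comment> \<open>The recurrence lemma starts at \<open>n = 1\<close>; the value at \<open>0\<close> is read off the first polynomial.\<close>
    define b where "b n = (if n = 0 then - coeff (racah_newton N 1) 0 else racah_b N n)" for n :: nat
    have "racah_newton N 1 = [:- b 0, 1:]"
      using racah_newton_degree[of N 1]
      by (intro poly_eqI) (auto simp: b_def coeff_pCons coeff_eq_0 split: nat.splits)
    moreover have "\<forall>n\<in>{1..N}. racah_u N n > 0 \<and> racah_newton N (n + 1) =
      [:- b n, 1:] * racah_newton N n - smult (racah_u N n) (racah_newton N (n - 1))"
    proof
      fix n assume n: "n \<in> {1..N}"
      then have "b n = racah_b N n" by (simp add: b_def)
      then show "racah_u N n > 0 \<and> racah_newton N (n + 1) =
        [:- b n, 1:] * racah_newton N n - smult (racah_u N n) (racah_newton N (n - 1))"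
        using racah_newton_rec[of n N] racah_u_pos[of n N] n by simp
    qed
    ultimately show ?thesis
      by (intro exI[of _ b] exI[of _ "\<lambda>n. racah_u (real N) (real n)"] conjI)
  qed
qed (rule racah_newton_degree)+

lemma poly_newton_basis_quadratic:
  "poly (newton_basis quadratic_grid k) (s * (s + 1)) =
     (- 1) ^ k * (pochhammer (- s) k * pochhammer (s + 1) k)"
  unfolding pochhammer_quadratic
  by (induction k) (simp_all add: newton_basis_def algebra_simps)

text \<open>
  Splitting each Pochhammer symbol of length \<open>n\<close> at \<open>k\<close> shows that the signed Newton
  coefficients are proportional to those of the series. The bound on \<open>n\<close> keeps the lower
  parameter \<open>- N\<close> from producing a zero denominator.
\<close>

lemma is_monic_racah_racah_newton:
  assumes "n \<le> N"
  shows "is_monic_racah n (- real N - 1) (- real N - 1/2) (1/2) (- 1/2) (racah_newton N n)"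
proof -
  define c where "c = real n - 2 * real N - 1/2"
  define \<kappa> where "\<kappa> = (pochhammer (- real N) n)\<^sup>2 * pochhammer (3/2) n / pochhammer c n"
  define a where "a k = pochhammer (- real n) k * pochhammer c k /
     (pochhammer (- real N) k * pochhammer (- real N) k * pochhammer (3/2) k * fact k)" for k
  have coeff: "racah_coeff N n k * (- 1) ^ k = \<kappa> * a k" if "k \<le> n" for k
  proof -
    have split: "pochhammer z n = pochhammer z k * pochhammer (z + real k) (n - k)" for z :: real
      using pochhammer_product[OF that, of z] by simp
    have nz: "pochhammer (- real N) k \<noteq> 0" "pochhammer (3/2 :: real) k \<noteq> 0" "pochhammer c k \<noteq> 0"
      using that assms pochhammer_half_odd_neq_0[of "int n - 2 * int N" k]
        pochhammer_half_odd_neq_0[of 2 k]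
      by (auto simp: pochhammer_eq_0_iff c_def)
    have binom: "real (n choose k) * (- 1) ^ k = pochhammer (- real n) k / fact k"
      by (simp add: binomial_gbinomial gbinomial_pochhammer)
    have "racah_coeff N n k * (- 1) ^ k = (real (n choose k) * (- 1) ^ k) *
        ((pochhammer (- real N + real k) (n - k))\<^sup>2 * pochhammer (3/2 + real k) (n - k) /
         pochhammer (c + real k) (n - k))"
      by (simp add: racah_coeff_def c_def algebra_simps)
    also have "\<dots> = \<kappa> * a k"
      unfolding binom \<kappa>_def a_def split using nz by (simp add: power2_eq_square mult_ac)
    finally show ?thesis .
  qed
  have "poly (racah_newton N n) (s * (s + 1)) =
      \<kappa> * racah_4F3 n (- real N - 1) (- real N - 1/2) (1/2) (- 1/2) s" for s
  proof -
    have "poly (racah_newton N n) (s * (s + 1)) =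
        (\<Sum>k\<le>n. (racah_coeff N n k * (- 1) ^ k) * (pochhammer (- s) k * pochhammer (s + 1) k))"
      by (simp add: racah_newton_def newton_sum_def poly_sum poly_newton_basis_quadratic mult.assoc)
    also have "\<dots> = (\<Sum>k\<le>n. \<kappa> * (a k * (pochhammer (- s) k * pochhammer (s + 1) k)))"
      by (intro sum.cong) (simp_all add: coeff mult.assoc)
    also have "\<dots> = \<kappa> * racah_4F3 n (- real N - 1) (- real N - 1/2) (1/2) (- 1/2) s"
      unfolding racah_4F3_def sum_distrib_left[symmetric]
      by (intro arg_cong2[of _ _ _ _ "(*)"] refl sum.cong)
         (simp_all add: a_def c_def algebra_simps)
    finally show ?thesis .
  qed
  then show ?thesis
    unfolding is_monic_racah_def using racah_newton_degree[of N n]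
    by (auto intro!: exI[of _ \<kappa>])
qed

theorem proposition3:
  fixes N :: nat and P :: "nat \<Rightarrow> real poly"
  assumes "N \<ge> 1"
    and "sturmian_sequence N (\<lambda>s. real s * (real s + 1)) P"
  shows "\<forall>n\<le>N. P n = racah n (- real N - 1) (- real N - 1/2) (1/2) (- 1/2)"
proof (intro allI impI)
  fix n assume "n \<le> N"
  then have "P n = racah_newton N n"
    by (rule sturmian_sequence_unique[OF assms(2) sturmian_sequence_racah_newton])
  also have "\<dots> = racah n (- real N - 1) (- real N - 1/2) (1/2) (- 1/2)"
    by (rule racah_eqI[OF is_monic_racah_racah_newton[OF \<open>n \<le> N\<close>], symmetric])
  finally show "P n = racah n (- real N - 1) (- real N - 1/2) (1/2) (- 1/2)" .
qed

end
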